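(* Let $K\in\mathbb R$, $N\in(1,\infty)$, and let $h$ be an $\mathrm{MCP}(K,N)$ density with $\operatorname{diam}(\operatorname{supp}h)=D\in(0,\infty)$. Then the following estimate holds: $$\lambda[h]\ge\lambda[h_{K,N,D}],$$ and it is sharp (the right-hand side cannot be replaced by a larger constant depending only on $K,N,D$).
   Context: For $\kappa\in\mathbb R$: $s_\kappa(\theta)=\frac1{\sqrt\kappa}\sin(\sqrt\kappa\,\theta)$ for $\theta\in[0,\pi/\sqrt\kappa]$ if $\kappa>0$; $s_0(\theta)=\theta$; $s_\kappa(\theta)=\frac1{\sqrt{-\kappa}}\sinh(\sqrt{-\kappa}\,\theta)$ if $\kappa<0$. $D_{K,N}:=\pi/\sqrt{K/(N-1)}$ if $K>0$ and $D_{K,N}:=+\infty$ otherwise. For $t\in[0,1]$, $\theta\ge0$: $\sigma^{(t)}_{K,N-1}(\theta):=+\infty$ if $\theta\ge D_{K,N}$ and $\sigma^{(t)}_{K,N-1}(\theta):=\frac{s_{K/(N-1)}(t\theta)}{s_{K/(N-1)}(\theta)}$ otherwise (interpreted as $t$ at $\theta=0$). A non-negative $h\in L^1_{loc}(\mathbb R)$ is an $\mathrm{MCP}(K,N)$ density if $h(tx_1+(1-t)x_0)\ge\sigma^{(1-t)}_{K,N-1}(|x_1-x_0|)^{N-1}h(x_0)$ for all $x_0,x_1\in\operatorname{supp}h$ and $t\in[0,1]$ (with $\infty\cdot0=0$), where $\operatorname{supp}h$ denotes the support of the measure $h\,dx$. (Necessarily $\operatorname{diam}(\operatorname{supp}h)\le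 D_{K,N}$.) For finite $D\in(0,D_{K,N}]$, $h_{K,N,D}(x)=s_{K/(N-1)}(D-x)^{N-1}$ for $x\in[0,D/2]$, $h_{K,N,D}(x)=s_{K/(N-1)}(x)^{N-1}$ for $x\in[D/2,D]$, and $0$ outside $[0,D]$. For a non-negative density $h$ on $\mathbb R$, $$\lambda[h]:=\inf\Big\{\frac{\int_{\mathbb R}|f'|^2h\,dx}{\int_{\mathbb R} f^2h\,dx}: f:\mathbb R\to\mathbb R\text{ locally Lipschitz},\ \int fh\,dx=0,\ 0<\int f^2h\,dx<\infty\Big\}.$$ *)

theory Defs
  imports "HOL-Analysis.Analysis"
begin

definition s_fun :: "real \<Rightarrow> real \<Rightarrow> real" where
  "s_fun \<kappa> \<theta> =
     (if \<kappa> > 0 then sin (sqrt \<kappa> * \<theta>) / sqrt \<kappa>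
      else if \<kappa> = 0 then \<theta>
      else sinh (sqrt (- \<kappa>) * \<theta>) / sqrt (- \<kappa>))"

definition D_KN :: "real \<Rightarrow> real \<Rightarrow> ereal" where
  "D_KN K N = (if K > 0 then ereal (pi / sqrt (K / (N - 1))) else \<infinity>)"

definition sigma_coeff :: "real \<Rightarrow> real \<Rightarrow> real \<Rightarrow> real \<Rightarrow> ennreal" where
  "sigma_coeff K N t \<theta> =
     (if ereal \<theta> \<ge> D_KN K N then \<infinity>
      else if \<theta> = 0 then ennreal t
      else ennreal (s_fun (K / (N - 1)) (t * \<theta>) / s_fun (K / (N - 1)) \<theta>))"

text \<open>Powers with a real exponent; used only for exponents \<^term>\<open>p > 0\<close>, where
  \<^term>\<open>\<infinity>\<close> to the power \<^term>\<open>p\<close> is \<^term>\<open>\<infinity>\<close>.\<close>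

definition ennreal_powr :: "ennreal \<Rightarrow> real \<Rightarrow> ennreal" where
  "ennreal_powr x p = (if x = \<infinity> then \<infinity> else ennreal (enn2real x powr p))"

definition measure_supp :: "'a::topological_space measure \<Rightarrow> 'a set" where
  "measure_supp M = {x. \<forall>U. open U \<and> x \<in> U \<longrightarrow> emeasure M U > 0}"

definition supp :: "(real \<Rightarrow> real) \<Rightarrow> real set" where
  "supp h = measure_supp (density lebesgue (\<lambda>x. ennreal (h x)))"

definition locally_integrable :: "(real \<Rightarrow> real) \<Rightarrow> bool" where
  "locally_integrable h \<longleftrightarrow> (\<forall>C. compact C \<longrightarrow> set_integrable lebesgue C h)"

text \<open>The density is a genuine function, not an a.e. class, because the inequality is required at
  every point of the support. In \<^typ>\<open>ennreal\<close> the convention \<^term>\<open>\<infinity> * 0 = (0::ennreal)\<close>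
  holds.\<close>

definition MCP_density :: "real \<Rightarrow> real \<Rightarrow> (real \<Rightarrow> real) \<Rightarrow> bool" where
  "MCP_density K N h \<longleftrightarrow>
     (\<forall>x. 0 \<le> h x) \<and> locally_integrable h \<and>
     (\<forall>x0\<in>supp h. \<forall>x1\<in>supp h. \<forall>t\<in>{0..1}.
        ennreal (h (t * x1 + (1 - t) * x0))
          \<ge> ennreal_powr (sigma_coeff K N (1 - t) \<bar>x1 - x0\<bar>) (N - 1) * ennreal (h x0))"

text \<open>Only meaningful for \<^term>\<open>0 < D\<close> and \<^term>\<open>ereal D \<le> D_KN K N\<close>, where the arguments of
  \<^const>\<open>s_fun\<close> lie in the range on which it is non-negative.\<close>

definition h_KND :: "real \<Rightarrow> real \<Rightarrow> real \<Rightarrow> real \<Rightarrow> real" where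
  "h_KND K N D x =
     (if x \<in> {0..D/2} then s_fun (K / (N - 1)) (D - x) powr (N - 1)
      else if x \<in> {D/2..D} then s_fun (K / (N - 1)) x powr (N - 1)
      else 0)"

definition locally_lipschitz :: "(real \<Rightarrow> real) \<Rightarrow> bool" where
  "locally_lipschitz f \<longleftrightarrow> (\<forall>x. \<exists>u>0. \<exists>L. L-lipschitz_on (cball x u) f)"

definition admissible :: "(real \<Rightarrow> real) \<Rightarrow> (real \<Rightarrow> real) \<Rightarrow> bool" where
  "admissible h f \<longleftrightarrow>
     locally_lipschitz f \<and>
     integrable lebesgue (\<lambda>x. f x * h x) \<and> (\<integral>x. f x * h x \<partial>lebesgue) = 0 \<and>
     integrable lebesgue (\<lambda>x. (f x)\<^sup>2 * h x) \<and> (\<integral>x. (f x)\<^sup>2 * h x \<partial>lebesgue) > 0"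

text \<open>A locally Lipschitz function is differentiable a.e., so the arbitrary value of \<^const>\<open>deriv\<close>
  at the remaining points does not matter. The numerator may be infinite, hence values in
  \<^typ>\<open>ennreal\<close>; the infimum over the empty set is \<^term>\<open>\<infinity>\<close>.\<close>

definition spectral_gap :: "(real \<Rightarrow> real) \<Rightarrow> ennreal" where
  "spectral_gap h =
     (INF f \<in> {f. admissible h f}.
        (\<integral>\<^sup>+x. ennreal ((deriv f x)\<^sup>2 * h x) \<partial>lebesgue) /
        (\<integral>\<^sup>+x. ennreal ((f x)\<^sup>2 * h x) \<partial>lebesgue))"

text \<open>The boundedness condition is needed because \<^const>\<open>diameter\<close> is unspecified on unbounded sets.\<close>

definition MCP_density_diam :: "real \<Rightarrow> real \<Rightarrow> real \<Rightarrow> (real \<Rightarrow> real) \<Rightarrow> bool" where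
  "MCP_density_diam K N D h \<longleftrightarrow>
     MCP_density K N h \<and> bounded (supp h) \<and> diameter (supp h) = D"

end

theory Submission
  imports Defs
begin

text \<open>The mean minimises the quadratic deviation, so \<open>f\<close> may be replaced by \<open>f - f(m)\<close>, where \<open>m\<close>
  is the midpoint of the support; this leaves a mixed Dirichlet-Neumann problem on each half of the
  support. By the MCP inequality with the far endpoint of the support, on each half \<open>h\<close> is the model
  density times a weight that does not increase with the distance from the midpoint. By the layer
  cake formula it suffices to treat weights that are indicators of initial intervals, and there one
  tests the model inequality with \<open>f - f(m)\<close> frozen beyond the interval. The mixed problem for the
  model density is bounded by its spectral gap through odd extension. The bound is attained because
  the model density is itself an MCP density.\<close>

section \<open>The model density\<close>

text \<open>The condition of zero mean couples the two halves and is destroyed by freezing a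
  function beyond a point; a zero at the midpoint survives freezing and lets each half be treated
  alone. This is why the mean is given up first. Why the far endpoint: let y be the distance to an
  endpoint p of the support. Contraction towards p says that the density divided by the power N - 1
  of s(y) does not increase with y. That power coincides with the model density only for y at least
  D/2, so each endpoint controls the opposite half, and both halves are mapped onto the right half
  of the model. No value of the spectral gap is computed and no minimiser or differential equation
  appears; the gap of the model enters only as a constant that holds for all competitors.\<close>

lemma s_fun_0 [simp]: "s_fun \<kappa> 0 = 0"
  by (simp add: s_fun_def)

lemma s_fun_minus [simp]: "s_fun \<kappa> (- \<theta>) = - s_fun \<kappa> \<theta>"
  by (simp add: s_fun_def)

lemma continuous_on_s_fun [continuous_intros]:
  fixes f :: "real \<Rightarrow> real"
  assumes "continuous_on A f"
  shows "continuous_on A (\<lambda>x. s_fun \<kappa> (f x))"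
proof -
  have "continuous_on A (\<lambda>x. sin (sqrt \<kappa> * f x) / sqrt \<kappa>)" if "\<kappa> > 0"
    using that by (intro continuous_intros assms) auto
  moreover have "continuous_on A (\<lambda>x. sinh (sqrt (- \<kappa>) * f x) / sqrt (- \<kappa>))" if "\<kappa> < 0"
    using that by (intro continuous_intros assms) auto
  ultimately show ?thesis
    using assms by (cases "\<kappa> > 0"; cases "\<kappa> = 0") (auto simp: s_fun_def)
qed

text \<open>The Pluecker relation among the determinants of four vectors in the plane, as
  \<^term>\<open>s_fun \<kappa> (x - y)\<close> is the determinant of the vectors with coordinates given by the
  generalized cosine and sine at \<^term>\<open>y\<close> and \<^term>\<open>x\<close>.\<close>

lemma s_fun_plucker:
  "s_fun \<kappa> (d - x) * s_fun \<kappa> (y - z) - s_fun \<kappa> (d - z) * s_fun \<kappa> (y - x)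
     = s_fun \<kappa> (d - y) * s_fun \<kappa> (x - z)"
  by (cases "\<kappa> > 0"; cases "\<kappa> = 0")
    (auto simp: s_fun_def sin_diff sinh_diff right_diff_distrib field_simps)

lemma s_fun_pos:
  assumes "1 < N" "0 < \<theta>" "ereal \<theta> < D_KN K N"
  shows "0 < s_fun (K / (N - 1)) \<theta>"
proof (cases "K > 0")
  case True
  then have *: "0 < sqrt (K / (N - 1))"
    using assms by simp
  have "\<theta> < pi / sqrt (K / (N - 1))"
    using assms True by (simp add: D_KN_def)
  then have "sqrt (K / (N - 1)) * \<theta> < pi"
    using * by (simp add: pos_less_divide_eq mult.commute)
  then have "0 < sin (sqrt (K / (N - 1)) * \<theta>)"
    using * assms by (intro sin_gt_zero) auto
  then show ?thesis
    using True assms * by (simp add: s_fun_def)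
next
  case False
  then show ?thesis
    using assms by (cases "K = 0") (auto simp: s_fun_def divide_less_0_iff zero_less_divide_iff intro!: divide_pos_pos)
qed

lemma s_fun_nonneg:
  assumes "1 < N" "0 \<le> \<theta>" "ereal \<theta> \<le> D_KN K N"
  shows "0 \<le> s_fun (K / (N - 1)) \<theta>"
proof -
  consider "\<theta> = 0" | "0 < \<theta>" "ereal \<theta> < D_KN K N" | "ereal \<theta> = D_KN K N"
    using assms by fastforce
  then show ?thesis
  proof cases
    case 3
    then have "K > 0" and "\<theta> = pi / sqrt (K / (N - 1))"
      by (auto simp: D_KN_def split: if_splits)
    then show ?thesis
      using \<open>1 < N\<close> by (simp add: s_fun_def)
  qed (use s_fun_pos[OF \<open>1 < N\<close>] in \<open>auto intro: less_imp_le\<close>)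
qed

text \<open>For K > 0 the function \<open>s_fun\<close> need not be monotone on [0, D]. The identity
  s(x)^2 - s(D - x)^2 = s(D) s(2x - D), a case of \<open>s_fun_plucker\<close>, decides the
  comparison instead.\<close>

lemma s_fun_reflect_le:
  assumes "1 < N" "ereal D \<le> D_KN K N" "D / 2 \<le> x" "x \<le> D"
  shows "s_fun (K / (N - 1)) (D - x) \<le> s_fun (K / (N - 1)) x"
proof -
  let ?s = "s_fun (K / (N - 1))"
  have ge: "0 \<le> ?s y" if "0 \<le> y" "y \<le> D" for y
    using that assms by (intro s_fun_nonneg) (auto intro: order_trans[of _ "ereal D"])
  have "?s (D - 0) * ?s (x - (D - x)) = ?s (D - x) * ?s (0 - (D - x)) - ?s (D - (D - x)) * ?s (0 - x)"
    by (rule s_fun_plucker[symmetric])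
  also have "\<dots> = (?s x)\<^sup>2 - (?s (D - x))\<^sup>2"
    unfolding diff_0 s_fun_minus by (simp add: power2_eq_square)
  finally have "(?s x)\<^sup>2 - (?s (D - x))\<^sup>2 \<ge> 0"
    using mult_nonneg_nonneg[OF ge[of "D - 0"] ge[of "x - (D - x)"]] assms by simp
  then show ?thesis
    using ge[of x] assms by (intro power2_le_imp_le[of "?s (D - x)" "?s x"]) auto
qed

text \<open>With a maximum in place of the case distinction, continuity at D/2 is immediate, and the
  contraction inequality can be checked separately for s(x) and s(D - x).\<close>

lemma h_KND_eq_max:
  assumes "1 < N" "ereal D \<le> D_KN K N" "x \<in> {0..D}"
  shows "h_KND K N D x = max (s_fun (K / (N - 1)) x) (s_fun (K / (N - 1)) (D - x)) powr (N - 1)"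
proof (cases "x \<le> D / 2")
  case True
  then show ?thesis
    using s_fun_reflect_le[OF assms(1,2), of "D - x"] assms(3) by (simp add: h_KND_def max_absorb2)
next
  case False
  then show ?thesis
    using s_fun_reflect_le[OF assms(1,2), of x] assms(3) by (simp add: h_KND_def max_absorb1)
qed

lemma h_KND_outside: "x \<notin> {0..D} \<Longrightarrow> 0 < D \<Longrightarrow> h_KND K N D x = 0"
  by (auto simp: h_KND_def)

lemma h_KND_right:
  assumes "D / 2 \<le> x" "x \<le> D" "0 < D"
  shows "h_KND K N D x = s_fun (K / (N - 1)) x powr (N - 1)"
  using assms by (auto simp: h_KND_def)

lemma h_KND_nonneg: "0 \<le> h_KND K N D x"
  by (simp add: h_KND_def)

lemma h_KND_reflect:
  assumes "0 < D"
  shows "h_KND K N D (D - x) = h_KND K N D x"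
  using assms by (auto simp: h_KND_def)

lemma continuous_on_h_KND:
  assumes "1 < N" "ereal D \<le> D_KN K N"
  shows "continuous_on {0..D} (h_KND K N D)"
proof -
  have "continuous_on {0..D}
      (\<lambda>x. max (s_fun (K / (N - 1)) x) (s_fun (K / (N - 1)) (D - x)) powr (N - 1))"
    using assms
    by (intro continuous_on_powr' continuous_intros)
      (auto simp: le_max_iff_disj intro!: s_fun_nonneg intro: order_trans[of _ "ereal D"])
  then show ?thesis
    by (rule continuous_on_eq) (use h_KND_eq_max[OF assms] in auto)
qed

lemma borel_measurable_h_KND [measurable]:
  "h_KND K N D \<in> borel_measurable borel"
proof -
  have [measurable]: "s_fun \<kappa> \<in> borel_measurable borel" for \<kappa>
    by (intro borel_measurable_continuous_onI continuous_intros)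
  show ?thesis
    unfolding h_KND_def[abs_def] by measurable
qed

lemma h_KND_pos:
  assumes "1 < N" "ereal D \<le> D_KN K N" "0 < x" "x < D"
  shows "0 < h_KND K N D x"
proof -
  have "ereal y < D_KN K N" if "y < D" for y
    using that assms(2) by (meson ereal_less_eq(3) less_ereal.simps(1) less_le_trans)
  then have "0 < s_fun (K / (N - 1)) x"
    using assms by (intro s_fun_pos) auto
  then show ?thesis
    using assms by (subst h_KND_eq_max) (auto simp: less_max_iff_disj)
qed

section \<open>Locally Lipschitz functions and their derivatives\<close>

lemma locally_lipschitz_continuous_on:
  assumes "locally_lipschitz f"
  shows "continuous_on UNIV f"
proof -
  have "isCont f x" for x
  proof -
    obtain u L where "u > 0" "L-lipschitz_on (cball x u) f"
      using assms unfolding locally_lipschitz_def by blast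
    then have "continuous_on (ball x u) f"
      by (meson ball_subset_cball lipschitz_on_continuous_on lipschitz_on_subset)
    then show ?thesis
      using \<open>u > 0\<close> by (simp add: continuous_on_eq_continuous_at)
  qed
  then show ?thesis
    by (simp add: continuous_at_imp_continuous_on)
qed

text \<open>A 1-Lipschitz inner map sends a ball into the ball of the same radius around the image
  point. This covers the truncations and reflections from which the competitors are built.\<close>

lemma locally_lipschitz_compose:
  assumes "locally_lipschitz f" "1-lipschitz_on UNIV g"
  shows "locally_lipschitz (\<lambda>x. f (g x))"
  unfolding locally_lipschitz_def
proof
  fix x
  obtain u L where u: "u > 0" and L: "L-lipschitz_on (cball (g x) u) f"
    using assms(1) unfolding locally_lipschitz_def by blast
  have "g ` cball x u \<subseteq> cball (g x) u"
    using lipschitz_onD[OF assms(2)] by (fastforce intro: order_trans)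
  then have "(L * 1)-lipschitz_on (cball x u) (\<lambda>x. f (g x))"
    by (intro lipschitz_on_compose2 lipschitz_on_subset[OF assms(2)] lipschitz_on_subset[OF L]) auto
  then show "\<exists>u>0. \<exists>L. L-lipschitz_on (cball x u) (\<lambda>x. f (g x))"
    using u by blast
qed

lemma locally_lipschitz_diff:
  assumes "locally_lipschitz f" "locally_lipschitz g"
  shows "locally_lipschitz (\<lambda>x. f x - g x)"
  unfolding locally_lipschitz_def
proof
  fix x
  obtain u L where u: "u > 0" "L-lipschitz_on (cball x u) f"
    using assms(1) unfolding locally_lipschitz_def by blast
  obtain v M where v: "v > 0" "M-lipschitz_on (cball x v) g"
    using assms(2) unfolding locally_lipschitz_def by blast
  have "(L + M)-lipschitz_on (cball x (min u v)) (\<lambda>x. f x - g x)"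
    by (intro lipschitz_on_diff lipschitz_on_subset[OF u(2)] lipschitz_on_subset[OF v(2)]) auto
  then show "\<exists>u>0. \<exists>L. L-lipschitz_on (cball x u) (\<lambda>x. f x - g x)"
    using u v by (intro exI[of _ "min u v"]) auto
qed

lemma locally_lipschitz_const: "locally_lipschitz (\<lambda>x. c)"
  unfolding locally_lipschitz_def using zero_less_one lipschitz_on_constant by blast

text \<open>The affine change is invertible, so either both functions are differentiable at the
  corresponding points or neither is. In the second case both values of \<open>deriv\<close> are the
  same unspecified constant, so the identity holds at every point; squaring removes the
  signs.\<close>

lemma deriv_reflect_shift:
  fixes f :: "real \<Rightarrow> real"
  assumes "e = 1 \<or> e = -1" "e' = 1 \<or> e' = -1"
  shows "(deriv (\<lambda>y. e' * f (p + e * y) + c) x)\<^sup>2 = (deriv f (p + e * x))\<^sup>2"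
proof -
  let ?g = "\<lambda>y. e' * f (p + e * y) + c"
  have fg: "(?g has_field_derivative (e' * e * d)) (at x)"
    if d: "(f has_field_derivative d) (at (p + e * x))" for d
  proof -
    have "((\<lambda>y. p + e * y) has_field_derivative e) (at x)"
      by (auto intro!: derivative_eq_intros)
    from DERIV_chain2[OF d this] show ?thesis
      by (auto intro!: derivative_eq_intros)
  qed
  have gf: "(f has_field_derivative (e' * e * d)) (at (p + e * x))"
    if d: "(?g has_field_derivative d) (at x)" for d
  proof -
    have inv: "e * (e * y) = y" "e' * (e' * y) = y" for y
      using assms by auto
    have "((\<lambda>z. e * (z - p)) has_field_derivative e) (at (p + e * x))"
      by (auto intro!: derivative_eq_intros)
    moreover have "e * (p + e * x - p) = x"
      by (simp add: inv)
    ultimately have "((\<lambda>z. ?g (e * (z - p))) has_field_derivative d * e) (at (p + e * x))"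
      using DERIV_chain2[of ?g d "\<lambda>z. e * (z - p)" "p + e * x" e UNIV] d by (simp only:)
    then have "((\<lambda>z. e' * (?g (e * (z - p)) - c)) has_field_derivative e' * (d * e - 0)) (at (p + e * x))"
      by (intro DERIV_cmult DERIV_diff DERIV_const)
    moreover have "(\<lambda>z. e' * (?g (e * (z - p)) - c)) = f"
      by (simp add: inv)
    ultimately show ?thesis
      by (simp add: mult_ac)
  qed
  show ?thesis
  proof (cases "\<exists>d. (f has_field_derivative d) (at (p + e * x))")
    case True
    then obtain d where d: "(f has_field_derivative d) (at (p + e * x))"
      by blast
    show ?thesis
      using DERIV_imp_deriv[OF d] DERIV_imp_deriv[OF fg[OF d]] assms by auto
  next
    case False
    then have "\<not> (\<exists>d. (?g has_field_derivative d) (at x))"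
      using gf by blast
    with False show ?thesis
      by (simp add: deriv_def)
  qed
qed

section \<open>Measurability of the derivative\<close>

text \<open>By continuity the increments satisfying a given error bound form a closed set, so it
  suffices to test rational ones. Only countable quantifiers remain, which makes the set of
  differentiability points measurable.\<close>

lemma has_field_derivative_iff_rational:
  fixes f :: "real \<Rightarrow> real"
  assumes f: "continuous_on UNIV f"
  shows "(f has_field_derivative d) (at x) \<longleftrightarrow>
    (\<forall>k::nat. \<exists>m::nat. \<forall>p\<in>\<rat>. \<bar>p\<bar> < 1 / Suc m \<longrightarrow> \<bar>f (x + p) - f x - d * p\<bar> \<le> \<bar>p\<bar> / Suc k)"
    (is "_ \<longleftrightarrow> ?R")
proof -
  have real: "\<bar>f (x + p) - f x - d * p\<bar> \<le> \<bar>p\<bar> / Suc k"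
    if m: "\<forall>p\<in>\<rat>. \<bar>p\<bar> < 1 / Suc m \<longrightarrow> \<bar>f (x + p) - f x - d * p\<bar> \<le> \<bar>p\<bar> / Suc k"
      and p: "\<bar>p\<bar> < 1 / Suc m" for p k m
  proof -
    let ?U = "{-1 / Suc m<..<1 / Suc m} :: real set"
    let ?S = "{q. \<bar>f (x + q) - f x - d * q\<bar> \<le> \<bar>q\<bar> / Suc k}"
    have "continuous_on UNIV (\<lambda>q. f (x + q))"
      by (intro continuous_on_compose2[OF f] continuous_intros) auto
    then have "closed ?S"
      by (intro closed_Collect_le continuous_intros) auto
    moreover have "?U \<inter> \<rat> \<subseteq> ?S"
      using m by (auto simp: abs_less_iff)
    ultimately have "closure (?U \<inter> \<rat>) \<subseteq> ?S"
      by (rule closure_minimal[rotated])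
    moreover have "?U \<subseteq> closure (?U \<inter> \<rat>)"
    proof -
      have "?U \<inter> closure \<rat> \<subseteq> closure (?U \<inter> \<rat>)"
        by (rule open_Int_closure_subset) auto
      then show ?thesis
        by (simp add: Rats_closure_real)
    qed
    moreover have "p \<in> ?U"
      using p by auto
    ultimately show ?thesis
      by blast
  qed
  have "(f has_field_derivative d) (at x) \<longleftrightarrow>
      (\<forall>e>0. \<exists>\<delta>>0. \<forall>p. \<bar>p\<bar> < \<delta> \<longrightarrow> \<bar>f (x + p) - f x - d * p\<bar> \<le> e * \<bar>p\<bar>)" (is "_ \<longleftrightarrow> ?E")
  proof -
    have "(f has_field_derivative d) (at x) \<longleftrightarrow>
      (\<forall>e>0. \<exists>\<delta>>0. \<forall>y. \<bar>y - x\<bar> < \<delta> \<longrightarrow> \<bar>f y - f x - d * (y - x)\<bar> \<le> e * \<bar>y - x\<bar>)"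
      by (simp add: has_field_derivative_def has_derivative_at_alt bounded_linear_mult_right)
    also have "\<dots> \<longleftrightarrow> ?E"
    proof -
      have "(\<forall>y. \<bar>y - x\<bar> < \<delta> \<longrightarrow> \<bar>f y - f x - d * (y - x)\<bar> \<le> e * \<bar>y - x\<bar>) \<longleftrightarrow>
            (\<forall>p. \<bar>p\<bar> < \<delta> \<longrightarrow> \<bar>f (x + p) - f x - d * p\<bar> \<le> e * \<bar>p\<bar>)" for \<delta> e
        by (metis add.commute add_diff_cancel diff_add_cancel)
      then show ?thesis
        by simp
    qed
    finally show ?thesis .
  qed
  also have "\<dots> \<longleftrightarrow> ?R"
  proof
    assume E: ?E
    show ?R
    proof
      fix k :: nat
      obtain \<delta> where \<delta>: "\<delta> > 0" "\<forall>p. \<bar>p\<bar> < \<delta> \<longrightarrow> \<bar>f (x + p) - f x - d * p\<bar> \<le> 1 / Suc k * \<bar>p\<bar>"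
        using E[rule_format, of "1 / Suc k"] by auto
      obtain m where "1 / real (Suc m) < \<delta>"
        using nat_approx_posE[OF \<delta>(1)] by blast
      then show "\<exists>m::nat. \<forall>p\<in>\<rat>. \<bar>p\<bar> < 1 / Suc m \<longrightarrow> \<bar>f (x + p) - f x - d * p\<bar> \<le> \<bar>p\<bar> / Suc k"
        using \<delta>(2) by (intro exI[of _ m]) auto
    qed
  next
    assume R: ?R
    show ?E
    proof (intro allI impI)
      fix e :: real assume "e > 0"
      then obtain k where k: "1 / real (Suc k) < e"
        using nat_approx_posE by blast
      obtain m where m: "\<forall>p\<in>\<rat>. \<bar>p\<bar> < 1 / Suc m \<longrightarrow> \<bar>f (x + p) - f x - d * p\<bar> \<le> \<bar>p\<bar> / Suc k"
        using R by blast
      have "\<bar>f (x + p) - f x - d * p\<bar> \<le> e * \<bar>p\<bar>" if "\<bar>p\<bar> < 1 / Suc m" for p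
      proof -
        have "\<bar>p\<bar> / Suc k \<le> e * \<bar>p\<bar>"
          using mult_right_mono[of "1 / Suc k" e "\<bar>p\<bar>"] k by simp
        then show ?thesis
          using real[OF m that] by linarith
      qed
      then show "\<exists>\<delta>>0. \<forall>p. \<bar>p\<bar> < \<delta> \<longrightarrow> \<bar>f (x + p) - f x - d * p\<bar> \<le> e * \<bar>p\<bar>"
        by (intro exI[of _ "1 / Suc m"]) auto
    qed
  qed
  finally show ?thesis .
qed

text \<open>Where the derivative does not exist, \<^const>\<open>deriv\<close> is one fixed unspecified constant.\<close>

lemma borel_measurable_deriv:
  fixes f :: "real \<Rightarrow> real"
  assumes f: "continuous_on UNIV f"
  shows "deriv f \<in> borel_measurable borel"
proof -
  have [measurable]: "f \<in> borel_measurable borel"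
    using f by (rule borel_measurable_continuous_onI)
  \<comment> \<open>A candidate that is Borel everywhere, since \<open>lim\<close> is total, and
    equals the derivative wherever one exists. Differentiability at x thus becomes the statement
    that \<open>g x\<close> is the derivative.\<close>
  define g where "g x = lim (\<lambda>n. (f (x + 1 / Suc n) - f x) / (1 / Suc n))" for x
  have [measurable]: "g \<in> borel_measurable borel"
    unfolding g_def by measurable
  have g: "g x = d" if "(f has_field_derivative d) (at x)" for x d
  proof -
    have "((\<lambda>h. (f (x + h) - f x) / h) \<longlongrightarrow> d) (at 0)"
      using that by (simp add: DERIV_def)
    moreover have "filterlim (\<lambda>n. 1 / real (Suc n)) (at 0) sequentially"
      by (simp add: filterlim_at LIMSEQ_Suc[OF lim_1_over_n] del: of_nat_Suc)
    ultimately have "(\<lambda>n. (f (x + 1 / Suc n) - f x) / (1 / Suc n)) \<longlonglongrightarrow> d"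
      by (rule filterlim_compose)
    then show ?thesis
      unfolding g_def by (rule limI)
  qed
  let ?A = "{x. (f has_field_derivative g x) (at x)}"
  have A: "?A = {x. \<forall>k::nat. \<exists>m::nat. \<forall>r. \<bar>of_rat r\<bar> < 1 / Suc m \<longrightarrow>
      \<bar>f (x + of_rat r) - f x - g x * of_rat r\<bar> \<le> \<bar>of_rat r\<bar> / Suc k}"
    by (simp add: has_field_derivative_iff_rational[OF f] Rats_def)
  have [measurable]: "?A \<in> sets borel"
    unfolding A by measurable
  have "deriv f x = (if x \<in> ?A then g x else (SOME d. False))" for x
  proof (cases "x \<in> ?A")
    case True
    then show ?thesis
      using DERIV_imp_deriv by auto
  next
    case False
    then have "\<not> (f has_field_derivative d) (at x)" for d
      using g by auto
    with False show ?thesis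
      by (simp add: deriv_def)
  qed
  then have "deriv f = (\<lambda>x. if x \<in> ?A then g x else (SOME d. False))"
    by blast
  also have "\<dots> \<in> borel_measurable borel"
    by measurable
  finally show ?thesis .
qed

section \<open>The mixed problem for the model density\<close>

text \<open>Admissibility makes the denominator nonzero and finite, so it may be cleared even if the
  numerator is infinite.\<close>

lemma spectral_gap_mult_le:
  assumes "admissible h f" "\<And>x. 0 \<le> h x"
  shows "spectral_gap h * (\<integral>\<^sup>+x. ennreal ((f x)\<^sup>2 * h x) \<partial>lebesgue)
    \<le> (\<integral>\<^sup>+x. ennreal ((deriv f x)\<^sup>2 * h x) \<partial>lebesgue)"
proof -
  let ?A = "\<integral>\<^sup>+x. ennreal ((deriv f x)\<^sup>2 * h x) \<partial>lebesgue"
  let ?B = "\<integral>\<^sup>+x. ennreal ((f x)\<^sup>2 * h x) \<partial>lebesgue"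
  have "?B = ennreal (\<integral>x. (f x)\<^sup>2 * h x \<partial>lebesgue)"
    using assms by (intro nn_integral_eq_integral) (auto simp: admissible_def)
  then have B: "?B \<noteq> 0" "?B \<noteq> \<infinity>"
    using assms(1) by (auto simp: admissible_def)
  have "spectral_gap h \<le> ?A / ?B"
    unfolding spectral_gap_def using assms(1) by (intro INF_lower) auto
  then have "spectral_gap h * ?B \<le> (?A / ?B) * ?B"
    by (rule mult_right_mono) simp
  also have "\<dots> = ?A"
    using B by (simp add: ennreal_divide_times ennreal_times_divide ennreal_mult_divide_eq)
  finally show ?thesis .
qed

lemma nn_integral_reflect_double:
  fixes \<Phi> :: "real \<Rightarrow> ennreal"
  assumes [measurable]: "\<Phi> \<in> borel_measurable borel" and \<Phi>: "\<And>x. \<Phi> (D - x) = \<Phi> x"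
  shows "(\<integral>\<^sup>+x. \<Phi> x \<partial>lborel) = 2 * (\<integral>\<^sup>+x. \<Phi> x * indicator {D/2<..} x \<partial>lborel)"
proof -
  have "(\<integral>\<^sup>+x. \<Phi> x \<partial>lborel)
      = (\<integral>\<^sup>+x. \<Phi> x * indicator {D/2<..} x + \<Phi> x * indicator {..<D/2} x \<partial>lborel)"
    using AE_lborel_singleton[of "D/2"]
    by (intro nn_integral_cong_AE, eventually_elim) (auto simp: indicator_def)
  also have "\<dots> = (\<integral>\<^sup>+x. \<Phi> x * indicator {D/2<..} x \<partial>lborel) + (\<integral>\<^sup>+x. \<Phi> x * indicator {..<D/2} x \<partial>lborel)"
    by (rule nn_integral_add) measurable
  also have "(\<integral>\<^sup>+x. \<Phi> x * indicator {..<D/2} x \<partial>lborel)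
      = (\<integral>\<^sup>+x. \<Phi> (D - x) * indicator {..<D/2} (D - x) \<partial>lborel)"
    using nn_integral_real_affine[of "\<lambda>x. \<Phi> x * indicator {..<D/2} x" "-1" D] by simp
  also have "\<dots> = (\<integral>\<^sup>+x. \<Phi> x * indicator {D/2<..} x \<partial>lborel)"
    by (intro nn_integral_cong) (auto simp: \<Phi> indicator_def field_simps)
  finally show ?thesis
    by (simp add: mult_2)
qed

lemma lipschitz_on_max_const: "1-lipschitz_on UNIV (\<lambda>x::real. max x c)"
  by (rule lipschitz_onI) (auto simp: dist_real_def max_def)

lemma lipschitz_on_min_const: "1-lipschitz_on UNIV (\<lambda>x::real. min x c)"
  by (rule lipschitz_onI) (auto simp: dist_real_def min_def)

lemma lipschitz_on_max_reflect: "1-lipschitz_on UNIV (\<lambda>x::real. max (d - x) c)"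
  by (rule lipschitz_onI) (auto simp: dist_real_def max_def)

text \<open>The odd extension of a function vanishing at the midpoint is a competitor for the
  symmetric density.\<close>

lemma spectral_gap_h_KND_half:
  assumes N: "1 < N" and D: "0 < D" "ereal D \<le> D_KN K N"
    and g: "locally_lipschitz g" "g (D/2) = 0"
  shows "spectral_gap (h_KND K N D) *
      (\<integral>\<^sup>+x. ennreal ((g x)\<^sup>2 * h_KND K N D x) * indicator {D/2<..} x \<partial>lborel)
    \<le> (\<integral>\<^sup>+x. ennreal ((deriv g x)\<^sup>2 * h_KND K N D x) * indicator {D/2<..} x \<partial>lborel)"
proof -
  let ?h = "h_KND K N D"
  \<comment> \<open>Since \<open>g (D/2) = 0\<close>, one of the two terms vanishes on each side of
    the midpoint. Writing the odd extension with \<open>max\<close> yields the Lipschitz property by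
    composition, with no gluing at D/2.\<close>
  define F where "F x = g (max x (D/2)) - g (max (D - x) (D/2))" for x
  have F: "locally_lipschitz F"
    unfolding F_def
    by (intro locally_lipschitz_diff locally_lipschitz_compose[OF g(1)]
        lipschitz_on_max_const lipschitz_on_max_reflect)
  have cont: "continuous_on UNIV F"
    using F by (rule locally_lipschitz_continuous_on)
  have [measurable]: "F \<in> borel_measurable borel" "deriv F \<in> borel_measurable borel"
    using cont borel_measurable_deriv[OF cont] by (auto intro: borel_measurable_continuous_onI)
  have odd: "F (D - x) = - F x" for x
    by (simp add: F_def)
  have "(deriv F (D - x))\<^sup>2 = (deriv F x)\<^sup>2" for x
    using deriv_reflect_shift[of "-1" "-1" F D 0 x] by (simp add: odd)
  then have dF: "(\<integral>\<^sup>+x. ennreal ((deriv F x)\<^sup>2 * ?h x) \<partial>lborel)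
      = 2 * (\<integral>\<^sup>+x. ennreal ((deriv F x)\<^sup>2 * ?h x) * indicator {D/2<..} x \<partial>lborel)"
    by (intro nn_integral_reflect_double) (auto simp: h_KND_reflect[OF D(1)])
  have F2: "(\<integral>\<^sup>+x. ennreal ((F x)\<^sup>2 * ?h x) \<partial>lborel)
      = 2 * (\<integral>\<^sup>+x. ennreal ((F x)\<^sup>2 * ?h x) * indicator {D/2<..} x \<partial>lborel)"
    by (intro nn_integral_reflect_double) (auto simp: h_KND_reflect[OF D(1)] odd)
  have Fg: "F x = g x" if "D/2 < x" for x
    using that g(2) by (simp add: F_def max_def)
  have dFg: "deriv F x = deriv g x" if "D/2 < x" for x
  proof (rule deriv_cong_ev)
    have "eventually (\<lambda>y. y \<in> {D/2<..}) (nhds x)"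
      using that by (intro eventually_nhds_in_open) auto
    then show "eventually (\<lambda>y. F y = g y) (nhds x)"
      by eventually_elim (use Fg in auto)
  qed simp
  have int: "integrable lborel (\<lambda>x. G x * ?h x)" if "continuous_on UNIV G" for G
  proof -
    have "integrable lborel (\<lambda>x. indicator {0..D} x *\<^sub>R (G x * ?h x))"
      using continuous_on_h_KND[OF N D(2)] that
      by (intro borel_integrable_compact continuous_intros) (auto intro: continuous_on_subset)
    moreover have "indicator {0..D} x *\<^sub>R (G x * ?h x) = G x * ?h x" for x
      using h_KND_outside[OF _ D(1), of x] by (auto simp: indicator_def)
    ultimately show ?thesis
      by (simp only:)
  qed
  have "(\<integral>x. F x * ?h x \<partial>lborel) = - (\<integral>x. F x * ?h x \<partial>lborel)"
    using lborel_integral_real_affine[of "-1" "\<lambda>x. F x * ?h x" D]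
    by (simp add: odd h_KND_reflect[OF D(1)])
  then have zero: "(\<integral>x. F x * ?h x \<partial>lborel) = 0"
    by simp
  have i2: "integrable lborel (\<lambda>x. (F x)\<^sup>2 * ?h x)"
    by (intro int continuous_intros cont)
  have "spectral_gap ?h * (\<integral>\<^sup>+x. ennreal ((F x)\<^sup>2 * ?h x) \<partial>lborel)
      \<le> (\<integral>\<^sup>+x. ennreal ((deriv F x)\<^sup>2 * ?h x) \<partial>lborel)"
  proof (cases "(\<integral>x. (F x)\<^sup>2 * ?h x \<partial>lborel) > 0")
    case True
    then have "admissible ?h F"
      unfolding admissible_def using F int[OF cont] i2 zero
      by (simp add: integrable_completion integral_completion)
    from spectral_gap_mult_le[OF this h_KND_nonneg] show ?thesis
      by (simp add: nn_integral_completion)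
  next
    \<comment> \<open>Here F is not admissible, but the left side is 0 even if the spectral gap is
      infinite.\<close>
    case False
    have "(\<integral>\<^sup>+x. ennreal ((F x)\<^sup>2 * ?h x) \<partial>lborel) = ennreal (\<integral>x. (F x)\<^sup>2 * ?h x \<partial>lborel)"
      using i2 by (intro nn_integral_eq_integral) (auto simp: h_KND_nonneg)
    with False show ?thesis
      by (simp add: ennreal_neg)
  qed
  then have "2 * (spectral_gap ?h * (\<integral>\<^sup>+x. ennreal ((F x)\<^sup>2 * ?h x) * indicator {D/2<..} x \<partial>lborel))
      \<le> 2 * (\<integral>\<^sup>+x. ennreal ((deriv F x)\<^sup>2 * ?h x) * indicator {D/2<..} x \<partial>lborel)"
    unfolding dF F2 by (simp add: mult_ac)
  then have "spectral_gap ?h * (\<integral>\<^sup>+x. ennreal ((F x)\<^sup>2 * ?h x) * indicator {D/2<..} x \<partial>lborel)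
      \<le> (\<integral>\<^sup>+x. ennreal ((deriv F x)\<^sup>2 * ?h x) * indicator {D/2<..} x \<partial>lborel)"
    by (subst (asm) ennreal_mult_le_mult_iff) auto
  also have "(\<integral>\<^sup>+x. ennreal ((deriv F x)\<^sup>2 * ?h x) * indicator {D/2<..} x \<partial>lborel)
      = (\<integral>\<^sup>+x. ennreal ((deriv g x)\<^sup>2 * ?h x) * indicator {D/2<..} x \<partial>lborel)"
    by (intro nn_integral_cong) (auto simp: indicator_def dFg)
  also have "(\<integral>\<^sup>+x. ennreal ((F x)\<^sup>2 * ?h x) * indicator {D/2<..} x \<partial>lborel)
      = (\<integral>\<^sup>+x. ennreal ((g x)\<^sup>2 * ?h x) * indicator {D/2<..} x \<partial>lborel)"
    by (intro nn_integral_cong) (auto simp: indicator_def Fg)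
  finally show ?thesis .
qed

section \<open>Non-increasing weights\<close>

text \<open>\<open>W x\<close> is the length of the set of s with 0 \<le> s < \<open>W x\<close>;
  Tonelli exchanges the two integrals.\<close>

lemma nn_integral_weight_eq_superlevel:
  fixes F :: "real \<Rightarrow> ennreal" and W :: "real \<Rightarrow> real"
  assumes [measurable]: "F \<in> borel_measurable borel" "W \<in> borel_measurable borel"
    and W: "\<And>x. 0 \<le> W x"
  shows "(\<integral>\<^sup>+x. F x * ennreal (W x) \<partial>lborel)
    = (\<integral>\<^sup>+s. (\<integral>\<^sup>+x. F x * indicator {x. s < W x} x \<partial>lborel) * indicator {0..} s \<partial>lborel)"
proof -
  have "(\<integral>\<^sup>+x. F x * ennreal (W x) \<partial>lborel)
      = (\<integral>\<^sup>+x. (\<integral>\<^sup>+s. F x * (indicator {x. s < W x} x * indicator {0..} s) \<partial>lborel) \<partial>lborel)"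
  proof (intro nn_integral_cong)
    fix x
    have "(\<integral>\<^sup>+s. F x * (indicator {x. s < W x} x * indicator {0..} s) \<partial>lborel)
        = (\<integral>\<^sup>+s. F x * indicator {0..<W x} s \<partial>lborel)"
      by (intro nn_integral_cong) (auto simp: indicator_def)
    also have "\<dots> = F x * ennreal (W x)"
      using W[of x] by (simp add: nn_integral_cmult)
    finally show "F x * ennreal (W x)
        = (\<integral>\<^sup>+s. F x * (indicator {x. s < W x} x * indicator {0..} s) \<partial>lborel)" ..
  qed
  also have "\<dots> = (\<integral>\<^sup>+s. (\<integral>\<^sup>+x. F x * (indicator {x. s < W x} x * indicator {0..} s) \<partial>lborel) \<partial>lborel)"
    by (rule lborel_pair.Fubini'[symmetric]) measurable
  also have "\<dots> = (\<integral>\<^sup>+s. (\<integral>\<^sup>+x. F x * indicator {x. s < W x} x \<partial>lborel) * indicator {0..} s \<partial>lborel)"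
    by (simp add: nn_integral_multc flip: mult.assoc)
  finally show ?thesis .
qed

text \<open>Truncating \<^term>\<open>g\<close> at \<^term>\<open>r\<close> shows that the inequality of the model density passes to every
  initial interval, hence by the layer cake formula to every non-increasing weight.\<close>

lemma spectral_gap_h_KND_half_weighted:
  assumes N: "1 < N" and D: "0 < D" "ereal D \<le> D_KN K N"
    and g: "locally_lipschitz g" "g (D/2) = 0"
    and W: "antimono_on {D/2..<D} W" "\<And>x. 0 \<le> W x"
  shows "spectral_gap (h_KND K N D) *
      (\<integral>\<^sup>+x. ennreal ((g x)\<^sup>2 * h_KND K N D x * W x) * indicator {D/2..<D} x \<partial>lborel)
    \<le> (\<integral>\<^sup>+x. ennreal ((deriv g x)\<^sup>2 * h_KND K N D x * W x) * indicator {D/2..<D} x \<partial>lborel)"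
proof -
  let ?h = "h_KND K N D" and ?L = "spectral_gap (h_KND K N D)"
  \<comment> \<open>W is controlled only on the half-open interval, so it is cut off outside.
    Monotonicity makes V Borel, although W will come from a density that is merely Lebesgue
    measurable.\<close>
  define V where "V x = indicator {D/2..<D} x * W x" for x
  have V: "0 \<le> V x" for x
    using W(2) by (simp add: V_def)
  have "mono_on {D/2..<D} (\<lambda>x. - W x)"
    using W(1) by (auto simp: monotone_on_def)
  then have "(\<lambda>x. - W x) \<in> borel_measurable (restrict_space borel {D/2..<D})"
    by (rule borel_measurable_mono_on_fnc)
  then have "(\<lambda>x. - (indicator {D/2..<D} x *\<^sub>R - W x)) \<in> borel_measurable borel"
    by (subst (asm) borel_measurable_restrict_space_iff) auto
  then have [measurable]: "V \<in> borel_measurable borel"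
    by (simp add: V_def[abs_def])
  have cont: "continuous_on UNIV g"
    using g(1) by (rule locally_lipschitz_continuous_on)
  have [measurable]: "g \<in> borel_measurable borel" "deriv g \<in> borel_measurable borel"
    using cont borel_measurable_deriv[OF cont] by (auto intro: borel_measurable_continuous_onI)
  have level: "?L * (\<integral>\<^sup>+x. ennreal ((g x)\<^sup>2 * ?h x) * indicator {x. s < V x} x \<partial>lborel)
      \<le> (\<integral>\<^sup>+x. ennreal ((deriv g x)\<^sup>2 * ?h x) * indicator {x. s < V x} x \<partial>lborel)"
    if "0 \<le> s" for s
  proof (cases "{x. s < V x} = {}")
    case False
    define S where "S = {x. s < V x}"
    define r where "r = Sup S"
    have S: "S \<subseteq> {D/2..<D}"
      using that by (auto simp: S_def V_def indicator_def split: if_splits)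
    have ne: "S \<noteq> {}" and bdd: "bdd_above S"
      using False S by (auto simp: S_def intro: bdd_above_mono[of "{D/2..<D}"])
    have le_r: "x \<le> r" if "x \<in> S" for x
      unfolding r_def using that bdd by (rule cSup_upper)
    \<comment> \<open>With \<open>le_r\<close> this shows that S is the interval from D/2 to r, up
      to its two endpoints.\<close>
    have down: "x \<in> S" if x: "D/2 < x" "x < r" for x
    proof -
      obtain y where y: "y \<in> S" "x < y"
        using x(2) unfolding r_def less_cSup_iff[OF ne bdd] by blast
      have "y \<in> {D/2..<D}"
        using y S by blast
      then have "s < W y"
        using y by (simp add: S_def V_def)
      also have "W y \<le> W x"
        using x y \<open>y \<in> {D/2..<D}\<close> by (intro monotone_onD[OF W(1), of x y, simplified]) auto
      finally show ?thesis
        using y x \<open>y \<in> {D/2..<D}\<close> by (simp add: S_def V_def)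
    qed
    have "D/2 \<le> r"
      using ne S le_r by fastforce
    define G where "G x = g (min x r)" for x
    have G: "locally_lipschitz G"
      unfolding G_def by (intro locally_lipschitz_compose[OF g(1)] lipschitz_on_min_const)
    have "G (D/2) = 0"
      using \<open>D/2 \<le> r\<close> g(2) by (simp add: G_def min_def)
    have dG: "deriv G x = deriv g x" if "x < r" for x
    proof (rule deriv_cong_ev)
      have "eventually (\<lambda>y. y \<in> {..<r}) (nhds x)"
        using that by (intro eventually_nhds_in_open) auto
      then show "eventually (\<lambda>y. G y = g y) (nhds x)"
        by eventually_elim (auto simp: G_def min_def)
    qed simp
    have dG0: "deriv G x = 0" if "r < x" for x
    proof -
      have "eventually (\<lambda>y. y \<in> {r<..}) (nhds x)"
        using that by (intro eventually_nhds_in_open) auto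
      then have "eventually (\<lambda>y. G y = g r) (nhds x)"
        by eventually_elim (auto simp: G_def min_def)
      then have "deriv G x = deriv (\<lambda>_. g r) x"
        by (intro deriv_cong_ev) auto
      then show ?thesis
        by simp
    qed
    \<comment> \<open>G agrees with g on S, and enlarging S to the whole half only increases this
      side.\<close>
    have "(\<integral>\<^sup>+x. ennreal ((g x)\<^sup>2 * ?h x) * indicator S x \<partial>lborel)
        \<le> (\<integral>\<^sup>+x. ennreal ((G x)\<^sup>2 * ?h x) * indicator {D/2<..} x \<partial>lborel)"
      using AE_lborel_singleton[of "D/2"]
      by (intro nn_integral_mono_AE, eventually_elim)
        (use S le_r in \<open>auto simp: indicator_def G_def min_absorb1\<close>)
    then have "?L * (\<integral>\<^sup>+x. ennreal ((g x)\<^sup>2 * ?h x) * indicator S x \<partial>lborel)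
        \<le> ?L * (\<integral>\<^sup>+x. ennreal ((G x)\<^sup>2 * ?h x) * indicator {D/2<..} x \<partial>lborel)"
      by (rule mult_left_mono) simp
    also have "\<dots> \<le> (\<integral>\<^sup>+x. ennreal ((deriv G x)\<^sup>2 * ?h x) * indicator {D/2<..} x \<partial>lborel)"
      by (rule spectral_gap_h_KND_half[OF N D G \<open>G (D/2) = 0\<close>])
    \<comment> \<open>Beyond r the derivative of G vanishes, so the energy of G lives on S. At r
      itself G may have a kink, but a point is null.\<close>
    also have "\<dots> \<le> (\<integral>\<^sup>+x. ennreal ((deriv g x)\<^sup>2 * ?h x) * indicator S x \<partial>lborel)"
      using AE_lborel_singleton[of r]
    proof (intro nn_integral_mono_AE, eventually_elim)
      fix x assume "x \<noteq> r"
      then consider "x \<le> D/2" | "D/2 < x" "x < r" | "r < x"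
        by linarith
      then show "ennreal ((deriv G x)\<^sup>2 * ?h x) * indicator {D/2<..} x
          \<le> ennreal ((deriv g x)\<^sup>2 * ?h x) * indicator S x"
        by cases (auto simp: dG dG0 down indicator_def)
    qed
    finally show ?thesis
      by (simp add: S_def)
  qed simp
  have eq: "(\<integral>\<^sup>+x. ennreal (\<phi> x * ?h x * W x) * indicator {D/2..<D} x \<partial>lborel)
      = (\<integral>\<^sup>+s. (\<integral>\<^sup>+x. ennreal (\<phi> x * ?h x) * indicator {x. s < V x} x \<partial>lborel) * indicator {0..} s \<partial>lborel)"
    if [measurable]: "\<phi> \<in> borel_measurable borel" and "\<And>x. 0 \<le> \<phi> x" for \<phi>
  proof -
    have "(\<integral>\<^sup>+x. ennreal (\<phi> x * ?h x * W x) * indicator {D/2..<D} x \<partial>lborel)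
        = (\<integral>\<^sup>+x. ennreal (\<phi> x * ?h x) * ennreal (V x) \<partial>lborel)"
      using that W(2) by (intro nn_integral_cong)
        (auto simp: V_def indicator_def h_KND_nonneg ennreal_mult)
    also have "\<dots> = (\<integral>\<^sup>+s. (\<integral>\<^sup>+x. ennreal (\<phi> x * ?h x) * indicator {x. s < V x} x \<partial>lborel)
        * indicator {0..} s \<partial>lborel)"
      by (rule nn_integral_weight_eq_superlevel) (auto simp: V)
    finally show ?thesis .
  qed
  have "?L * (\<integral>\<^sup>+x. ennreal ((g x)\<^sup>2 * ?h x * W x) * indicator {D/2..<D} x \<partial>lborel)
      = (\<integral>\<^sup>+s. ?L * ((\<integral>\<^sup>+x. ennreal ((g x)\<^sup>2 * ?h x) * indicator {x. s < V x} x \<partial>lborel)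
          * indicator {0..} s) \<partial>lborel)"
    by (subst eq) (auto intro!: nn_integral_cmult[symmetric])
  also have "\<dots> \<le> (\<integral>\<^sup>+s. (\<integral>\<^sup>+x. ennreal ((deriv g x)\<^sup>2 * ?h x) * indicator {x. s < V x} x \<partial>lborel)
          * indicator {0..} s \<partial>lborel)"
  proof (intro nn_integral_mono)
    fix s :: real
    show "?L * ((\<integral>\<^sup>+x. ennreal ((g x)\<^sup>2 * ?h x) * indicator {x. s < V x} x \<partial>lborel) * indicator {0..} s)
        \<le> (\<integral>\<^sup>+x. ennreal ((deriv g x)\<^sup>2 * ?h x) * indicator {x. s < V x} x \<partial>lborel) * indicator {0..} s"
      using level[of s] by (cases "0 \<le> s") simp_all
  qed
  also have "\<dots> = (\<integral>\<^sup>+x. ennreal ((deriv g x)\<^sup>2 * ?h x * W x) * indicator {D/2..<D} x \<partial>lborel)"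
    by (subst eq) auto
  finally show ?thesis .
qed

section \<open>Comparison with the model density\<close>

lemma locally_integrable_measurable:
  assumes "locally_integrable h"
  shows "h \<in> borel_measurable lebesgue"
proof (rule borel_measurable_LIMSEQ_real)
  fix n :: nat
  have "set_integrable lebesgue {- real n..real n} h"
    using assms by (simp add: locally_integrable_def)
  then show "(\<lambda>x. indicator {- real n..real n} x * h x) \<in> borel_measurable lebesgue"
    by (simp add: set_integrable_def)
next
  fix x :: real
  obtain n :: nat where n: "\<bar>x\<bar> < real n"
    using reals_Archimedean2 by blast
  have "eventually (\<lambda>k. indicator {- real k..real k} x * h x = h x) sequentially"
    using eventually_ge_at_top[of n] by eventually_elim (use n in \<open>auto simp: indicator_def\<close>)
  then show "(\<lambda>n. indicator {- real n..real n} x * h x) \<longlonglongrightarrow> h x"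
    by (rule tendsto_eventually)
qed

lemma open_in_sets_lebesgue: "open U \<Longrightarrow> U \<in> sets lebesgue"
  by (simp add: borel_open)

lemma emeasure_density_lebesgue_eq_0_iff:
  assumes "h \<in> borel_measurable lebesgue" "\<And>x. 0 \<le> h x" "U \<in> sets lebesgue"
  shows "emeasure (density lebesgue (\<lambda>x. ennreal (h x))) U = 0
    \<longleftrightarrow> (AE x in lebesgue. x \<in> U \<longrightarrow> h x = 0)"
proof -
  have "emeasure (density lebesgue (\<lambda>x. ennreal (h x))) U
      = (\<integral>\<^sup>+x. ennreal (h x) * indicator U x \<partial>lebesgue)"
    using assms by (intro emeasure_density) auto
  also have "\<dots> = 0 \<longleftrightarrow> (AE x in lebesgue. ennreal (h x) * indicator U x = 0)"
    using assms by (intro nn_integral_0_iff_AE) auto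
  also have "\<dots> \<longleftrightarrow> (AE x in lebesgue. x \<in> U \<longrightarrow> h x = 0)"
  proof (rule AE_cong)
    fix x
    show "ennreal (h x) * indicator U x = 0 \<longleftrightarrow> (x \<in> U \<longrightarrow> h x = 0)"
      using assms(2)[of x] by (auto simp: indicator_def ennreal_eq_0_iff)
  qed
  finally show ?thesis .
qed

lemma supp_eq_Compl_Union:
  "supp h = - \<Union>{U. open U \<and> emeasure (density lebesgue (\<lambda>x. ennreal (h x))) U = 0}"
  unfolding supp_def measure_supp_def by (auto simp: zero_less_iff_neq_zero)

lemma closed_supp: "closed (supp h)"
  unfolding supp_eq_Compl_Union by (intro closed_Compl open_Union) auto

text \<open>The complement of the support is a possibly uncountable union of open null sets; the
  Lindelof property reduces it to a countable one.\<close>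

lemma AE_zero_outside_supp:
  assumes "h \<in> borel_measurable lebesgue" "\<And>x. 0 \<le> h x"
  shows "AE x in lebesgue. x \<notin> supp h \<longrightarrow> h x = 0"
proof -
  let ?M = "density lebesgue (\<lambda>x. ennreal (h x))"
  let ?F = "{U. open U \<and> emeasure ?M U = 0}"
  obtain F' where F': "F' \<subseteq> ?F" "countable F'" "\<Union>F' = \<Union>?F"
    using Lindelof[of ?F] by blast
  have "AE x in lebesgue. \<forall>U\<in>F'. x \<in> U \<longrightarrow> h x = 0"
  proof (subst AE_ball_countable[OF F'(2)], intro ballI)
    fix U assume "U \<in> F'"
    then have "open U" "emeasure ?M U = 0"
      using F'(1) by auto
    then show "AE x in lebesgue. x \<in> U \<longrightarrow> h x = 0"
      using emeasure_density_lebesgue_eq_0_iff[OF assms open_in_sets_lebesgue] by blast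
  qed
  then show ?thesis
  proof eventually_elim
    case (elim x)
    then show ?case
      unfolding supp_eq_Compl_Union F'(3)[symmetric] by blast
  qed
qed

text \<open>The density may vanish at a point of its support, where the MCP inequality gives
  nothing. Were it zero on the part of the support inside U, it would vanish almost everywhere on
  U.\<close>

lemma supp_imp_pos_nearby:
  assumes "h \<in> borel_measurable lebesgue" "\<And>x. 0 \<le> h x" "x \<in> supp h" "open U" "x \<in> U"
  shows "\<exists>y\<in>U \<inter> supp h. 0 < h y"
proof (rule ccontr)
  assume "\<not> ?thesis"
  then have *: "h y = 0" if "y \<in> U" "y \<in> supp h" for y
    using that assms(2)[of y] by force
  have "AE y in lebesgue. y \<in> U \<longrightarrow> h y = 0"
    using AE_zero_outside_supp[OF assms(1,2)] by eventually_elim (use * in auto)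
  then have "emeasure (density lebesgue (\<lambda>x. ennreal (h x))) U = 0"
    using emeasure_density_lebesgue_eq_0_iff[OF assms(1,2) open_in_sets_lebesgue[OF assms(4)]] by blast
  then show False
    using assms(3-5) unfolding supp_def measure_supp_def by auto
qed

text \<open>The part of U outside the support is open and, by positivity of the density, null; hence
  it is empty.\<close>

lemma pos_nearby_imp_supp:
  assumes h: "h \<in> borel_measurable lebesgue" "\<And>x. 0 \<le> h x"
    and U: "open U" "x \<in> U" "\<And>y. y \<in> U \<Longrightarrow> 0 < h y"
  shows "x \<in> supp h"
proof (rule ccontr)
  assume "x \<notin> supp h"
  have "AE y in lebesgue. y \<notin> U \<inter> - supp h"
    using AE_zero_outside_supp[OF h] by eventually_elim (use U(3) in force)
  moreover have op: "open (U \<inter> - supp h)"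
    using U(1) closed_supp by (intro open_Int) auto
  ultimately have "U \<inter> - supp h \<in> null_sets lebesgue"
    using AE_iff_null_sets[OF open_in_sets_lebesgue[OF op]] by simp
  then have "negligible (U \<inter> - supp h)"
    by (simp add: negligible_iff_null_sets)
  then show False
    using open_not_negligible[OF op] U(2) \<open>x \<notin> supp h\<close> by blast
qed

section \<open>Contraction towards a point of the support\<close>

text \<open>At t = 0 both sides of the MCP inequality refer to x0, so an infinite coefficient would
  force \<open>h x0 = 0\<close>.\<close>

lemma MCP_density_diam_less:
  assumes "MCP_density K N h" "x0 \<in> supp h" "x1 \<in> supp h" "0 < h x0"
  shows "ereal \<bar>x1 - x0\<bar> < D_KN K N"
proof (rule ccontr)
  assume "\<not> ?thesis"
  then have \<sigma>: "sigma_coeff K N 1 \<bar>x1 - x0\<bar> = \<infinity>"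
    by (simp add: sigma_coeff_def not_less)
  have "\<forall>t\<in>{0..1}. ennreal_powr (sigma_coeff K N (1 - t) \<bar>x1 - x0\<bar>) (N - 1) * ennreal (h x0)
      \<le> ennreal (h (t * x1 + (1 - t) * x0))"
    using assms unfolding MCP_density_def by blast
  from this[rule_format, of 0] show False
    using assms(4) by (simp add: \<sigma> ennreal_powr_def ennreal_top_mult top_unique)
qed

text \<open>The MCP inequality with target p and t = 1 - y/y0, which moves \<open>p + e * y0\<close>
  to \<open>p + e * y\<close>. The sign e lets the two ends of the support share one
  argument.\<close>

lemma MCP_density_ge:
  assumes N: "1 < N" and h: "MCP_density K N h"
    and e: "e = 1 \<or> e = -1" and p: "p \<in> supp h" "p + e * y0 \<in> supp h"
    and y: "0 \<le> y" "y \<le> y0" "0 < y0" and pos: "0 < h (p + e * y0)"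
  shows "(s_fun (K / (N - 1)) y / s_fun (K / (N - 1)) y0) powr (N - 1) * h (p + e * y0) \<le> h (p + e * y)"
    and "ereal y0 < D_KN K N"
proof -
  let ?s = "s_fun (K / (N - 1))"
  have dist: "\<bar>p - (p + e * y0)\<bar> = y0"
    using e y by auto
  show less: "ereal y0 < D_KN K N"
    using MCP_density_diam_less[OF h p(2,1) pos] unfolding dist .
  have "0 < ?s y0"
    using N y less by (intro s_fun_pos)
  moreover have "0 \<le> ?s y"
    using N y less by (intro s_fun_nonneg) (auto intro: order_trans[of _ "ereal y0"])
  ultimately have nn: "0 \<le> ?s y / ?s y0"
    by simp
  have "y / y0 * y0 = y"
    using y by simp
  then have \<sigma>: "sigma_coeff K N (y / y0) \<bar>p - (p + e * y0)\<bar> = ennreal (?s y / ?s y0)"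
    unfolding dist using less y by (simp add: sigma_coeff_def)
  have t: "1 - y / y0 \<in> {0..1}"
    using y by (simp add: field_simps)
  have "ennreal_powr (sigma_coeff K N (1 - (1 - y / y0)) \<bar>p - (p + e * y0)\<bar>) (N - 1) * ennreal (h (p + e * y0))
      \<le> ennreal (h ((1 - y / y0) * p + (1 - (1 - y / y0)) * (p + e * y0)))"
    using h p t unfolding MCP_density_def by blast
  moreover have "(1 - y / y0) * p + (1 - (1 - y / y0)) * (p + e * y0) = p + e * y"
    using y by (simp add: field_simps)
  ultimately have "ennreal ((?s y / ?s y0) powr (N - 1)) * ennreal (h (p + e * y0)) \<le> ennreal (h (p + e * y))"
    using nn \<sigma> by (simp add: ennreal_powr_def)
  then show "(?s y / ?s y0) powr (N - 1) * h (p + e * y0) \<le> h (p + e * y)"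
    using h by (simp add: MCP_density_def flip: ennreal_mult)
qed

text \<open>Off its support \<^term>\<open>h\<close> vanishes only almost everywhere, so pointwise monotonicity needs the
  restriction of \<^term>\<open>h\<close> to its support.\<close>

lemma MCP_density_restricted_ge:
  assumes N: "1 < N" and h: "MCP_density K N h"
    and e: "e = 1 \<or> e = -1" and p: "p \<in> supp h" and y: "0 < y" "y \<le> y0"
  shows "(s_fun (K / (N - 1)) y / s_fun (K / (N - 1)) y0) powr (N - 1)
      * (indicator (supp h) (p + e * y0) * h (p + e * y0))
    \<le> indicator (supp h) (p + e * y) * h (p + e * y)"
proof (cases "p + e * y0 \<in> supp h \<and> 0 < h (p + e * y0)")
  case True
  let ?s = "s_fun (K / (N - 1))"
  have h': "h \<in> borel_measurable lebesgue" "\<And>x. 0 \<le> h x"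
    using h by (auto simp: MCP_density_def intro: locally_integrable_measurable)
  have less: "ereal y0 < D_KN K N"
    using MCP_density_ge(2)[OF N h e p _ _ _ _, of y0 y] True y by simp
  \<comment> \<open>Positivity spreads from \<open>p + e * y0\<close> along the whole segment
    towards p, and an open segment on which h is positive lies in the support.\<close>
  have pos: "0 < h (p + e * z)" if "0 < z" "z \<le> y0" for z
  proof -
    have "ereal z < D_KN K N"
      using that less by (auto intro: le_less_trans[of _ "ereal y0"])
    then have "0 < ?s z" "0 < ?s y0"
      using that less N y by (auto intro: s_fun_pos)
    then have "0 < (?s z / ?s y0) powr (N - 1) * h (p + e * y0)"
      using True by simp
    also have "\<dots> \<le> h (p + e * z)"
      using MCP_density_ge(1)[OF N h e p, of y0 z] True that by simp
    finally show ?thesis .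
  qed
  have "p + e * y \<in> supp h"
  proof (cases "y = y0")
    case False
    let ?U = "{x. 0 < e * (x - p) \<and> e * (x - p) < y0}"
    have "open ?U"
      by (intro open_Collect_conj open_Collect_less continuous_intros)
    moreover have "p + e * y \<in> ?U"
      using e y False by auto
    moreover have "0 < h x" if "x \<in> ?U" for x
      using pos[of "e * (x - p)"] that e by auto
    ultimately show ?thesis
      by (rule pos_nearby_imp_supp[OF h'])
  qed (use True in simp)
  then show ?thesis
    using MCP_density_ge(1)[OF N h e p, of y0 y] True y by simp
next
  case False
  then have "indicator (supp h) (p + e * y0) * h (p + e * y0) = 0"
    using h by (auto simp: MCP_density_def indicator_def order.antisym not_less)
  moreover have "0 \<le> indicator (supp h) (p + e * y) * h (p + e * y)"
    using h by (simp add: MCP_density_def)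
  ultimately show ?thesis
    by (simp only: mult_zero_right)
qed

text \<open>In the application p is an endpoint of the support, J is the half far from p, and c is
  the value of f at the midpoint. The change of variables x = p + e y turns J into [D/2, D). The
  point D is left out because the model density vanishes there when D equals
  \<open>D_KN K N\<close>.\<close>

lemma MCP_density_half:
  assumes N: "1 < N" and D: "0 < D" "ereal D \<le> D_KN K N"
    and h: "MCP_density K N h" and f: "locally_lipschitz f"
    and e: "e = 1 \<or> e = -1" and p: "p \<in> supp h" and c: "c = f (p + e * (D/2))"
  defines "H \<equiv> \<lambda>x. indicator (supp h) x * h x"
    and "J \<equiv> {x. D/2 \<le> e * (x - p) \<and> e * (x - p) < D}"
  shows "spectral_gap (h_KND K N D) * (\<integral>\<^sup>+x. ennreal ((f x - c)\<^sup>2 * H x) * indicator J x \<partial>lebesgue)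
    \<le> (\<integral>\<^sup>+x. ennreal ((deriv f x)\<^sup>2 * H x) * indicator J x \<partial>lebesgue)"
proof -
  let ?k = "h_KND K N D" and ?s = "s_fun (K / (N - 1))"
  have [measurable]: "h \<in> borel_measurable lebesgue"
    using h by (auto simp: MCP_density_def intro: locally_integrable_measurable)
  have [measurable]: "supp h \<in> sets lebesgue"
    using closed_supp by (simp add: borel_closed)
  have [measurable]: "H \<in> borel_measurable lebesgue"
    unfolding H_def by measurable
  have H: "0 \<le> H x" for x
    using h by (simp add: H_def MCP_density_def)
  have [measurable]: "J \<in> sets lebesgue"
    unfolding J_def by simp
  have cont: "continuous_on UNIV f"
    using f by (rule locally_lipschitz_continuous_on)
  have [measurable]: "f \<in> borel_measurable lebesgue" "deriv f \<in> borel_measurable lebesgue"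
    using cont borel_measurable_deriv[OF cont]
    by (auto intro!: measurable_completion borel_measurable_continuous_onI)
  define g where "g y = f (p + e * y) - c" for y
  have "1-lipschitz_on UNIV (\<lambda>y. p + e * y)"
    using e by (intro lipschitz_onI) (auto simp: dist_real_def)
  then have g: "locally_lipschitz g"
    unfolding g_def by (intro locally_lipschitz_diff locally_lipschitz_const locally_lipschitz_compose[OF f])
  have g0: "g (D/2) = 0"
    by (simp add: g_def c)
  have dg: "(deriv g y)\<^sup>2 = (deriv f (p + e * y))\<^sup>2" for y
    using deriv_reflect_shift[OF e, of 1 f p "- c" y] by (simp add: g_def[abs_def])
  \<comment> \<open>The ratio to the model density. On the half in question the model is the power N
    - 1 of s(y), so the contraction inequality is exactly monotonicity of this ratio.\<close>
  define W where "W y = H (p + e * y) / ?k y" for y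
  have spos: "0 < ?s y" if "0 < y" "y < D" for y
    using that D N by (intro s_fun_pos) (auto intro: less_le_trans[of _ "ereal D"])
  have W: "antimono_on {D/2..<D} W"
  proof (rule monotone_onI)
    fix y y0 assume y: "y \<in> {D/2..<D}" "y0 \<in> {D/2..<D}" "y \<le> y0"
    have "(?s y / ?s y0) powr (N - 1) * H (p + e * y0) \<le> H (p + e * y)"
      using MCP_density_restricted_ge[OF N h e p, of y y0] y D by (simp add: H_def)
    then show "W y0 \<le> W y"
      using y D spos[of y] spos[of y0]
      by (simp add: W_def h_KND_right powr_divide field_simps)
  qed
  have W0: "0 \<le> W y" for y
    by (simp add: W_def H h_KND_nonneg)
  have subst: "(\<integral>\<^sup>+x. ennreal (\<phi> x * H x) * indicator J x \<partial>lebesgue)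
      = (\<integral>\<^sup>+y. ennreal (\<phi> (p + e * y) * ?k y * W y) * indicator {D/2..<D} y \<partial>lborel)"
    if [measurable]: "\<phi> \<in> borel_measurable lebesgue" for \<phi>
  proof -
    have "(\<integral>\<^sup>+x. ennreal (\<phi> x * H x) * indicator J x \<partial>lebesgue)
        = ennreal \<bar>e\<bar> * (\<integral>\<^sup>+y. ennreal (\<phi> (p + e * y) * H (p + e * y)) * indicator J (p + e * y) \<partial>lebesgue)"
      using e by (intro nn_integral_real_affine_lebesgue) auto
    also have "\<dots> = (\<integral>\<^sup>+y. ennreal (\<phi> (p + e * y) * H (p + e * y)) * indicator J (p + e * y) \<partial>lborel)"
      using e by (auto simp: nn_integral_completion)
    also have "\<dots> = (\<integral>\<^sup>+y. ennreal (\<phi> (p + e * y) * ?k y * W y) * indicator {D/2..<D} y \<partial>lborel)"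
    proof (intro nn_integral_cong)
      fix y
      have "p + e * y \<in> J \<longleftrightarrow> y \<in> {D/2..<D}"
        using e by (auto simp: J_def)
      moreover have "?k y * W y = H (p + e * y)" if "y \<in> {D/2..<D}"
        using that h_KND_pos[OF N D(2), of y] D(1) by (simp add: W_def)
      ultimately show "ennreal (\<phi> (p + e * y) * H (p + e * y)) * indicator J (p + e * y)
          = ennreal (\<phi> (p + e * y) * ?k y * W y) * indicator {D/2..<D} y"
        by (auto simp: indicator_def mult.assoc)
    qed
    finally show ?thesis .
  qed
  show ?thesis
    using spectral_gap_h_KND_half_weighted[OF N D g g0 W W0]
    by (simp add: subst dg) (simp add: g_def)
qed

lemma MCP_density_diamE:
  assumes "MCP_density_diam K N D h" "0 < D"
  obtains a where "a \<in> supp h" "a + D \<in> supp h" "supp h \<subseteq> {a..a + D}"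
proof -
  let ?S = "supp h"
  have S: "bounded ?S" "diameter ?S = D"
    using assms(1) by (auto simp: MCP_density_diam_def)
  then have "?S \<noteq> {}"
    using assms(2) by auto
  have "compact ?S"
    using S closed_supp by (simp add: compact_eq_bounded_closed)
  obtain a where a: "a \<in> ?S" "\<And>x. x \<in> ?S \<Longrightarrow> a \<le> x"
    using compact_attains_inf[OF \<open>compact ?S\<close> \<open>?S \<noteq> {}\<close>] by blast
  obtain b where b: "b \<in> ?S" "\<And>x. x \<in> ?S \<Longrightarrow> x \<le> b"
    using compact_attains_sup[OF \<open>compact ?S\<close> \<open>?S \<noteq> {}\<close>] by blast
  have "b - a \<le> D"
    using diameter_bounded_bound[OF S(1) b(1) a(1)] S(2) by (simp add: dist_real_def)
  moreover have "norm (x - y) \<le> b - a" if "x \<in> ?S" "y \<in> ?S" for x y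
    using a(2)[OF that(1)] b(2)[OF that(1)] a(2)[OF that(2)] b(2)[OF that(2)] by auto
  then have "D \<le> b - a"
    using diameter_le[of ?S "b - a"] \<open>?S \<noteq> {}\<close> S(2) by blast
  ultimately have "b = a + D"
    by simp
  with a b show thesis
    by (intro that[of a]) auto
qed

text \<open>The density may vanish at the endpoint a, so a point of positive density closer than D -
  d to a is used in its place; its distance to a + D still exceeds d.\<close>

lemma MCP_density_diam_le:
  assumes "MCP_density_diam K N D h" "0 < D"
  shows "ereal D \<le> D_KN K N"
proof (rule ccontr)
  assume "\<not> ?thesis"
  then have less: "D_KN K N < ereal D"
    by simp
  then obtain d where d: "D_KN K N = ereal d" "d < D"
    by (auto simp: D_KN_def split: if_splits)
  obtain a where a: "a \<in> supp h" "a + D \<in> supp h" "supp h \<subseteq> {a..a + D}"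
    using MCP_density_diamE[OF assms] .
  have h: "MCP_density K N h" "h \<in> borel_measurable lebesgue" "\<And>x. 0 \<le> h x"
    using assms by (auto simp: MCP_density_diam_def MCP_density_def intro: locally_integrable_measurable)
  obtain x where x: "x \<in> ball a (D - d)" "x \<in> supp h" "0 < h x"
    using supp_imp_pos_nearby[OF h(2,3) a(1), of "ball a (D - d)"] d(2) by auto
  have "\<bar>a + D - x\<bar> < d"
    using MCP_density_diam_less[OF h(1) x(2) a(2) x(3)] d(1) by simp
  then show False
    using x(1) by (auto simp: dist_real_def)
qed

lemma spectral_gap_MCP_ge:
  assumes N: "1 < N" and D: "0 < D" and hD: "MCP_density_diam K N D h"
  shows "spectral_gap (h_KND K N D) \<le> spectral_gap h"
  unfolding spectral_gap_def[of h]
proof (rule INF_greatest)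
  fix f assume "f \<in> {f. admissible h f}"
  then have adm: "admissible h f"
    by simp
  then have f: "locally_lipschitz f"
    by (simp add: admissible_def)
  let ?L = "spectral_gap (h_KND K N D)"
  have DK: "ereal D \<le> D_KN K N"
    by (rule MCP_density_diam_le[OF hD D])
  have h: "MCP_density K N h" "\<And>x. 0 \<le> h x"
    using hD by (auto simp: MCP_density_diam_def MCP_density_def)
  then have [measurable]: "h \<in> borel_measurable lebesgue"
    by (auto simp: MCP_density_def intro: locally_integrable_measurable)
  have [measurable]: "supp h \<in> sets lebesgue"
    using closed_supp by (simp add: borel_closed)
  obtain a where a: "a \<in> supp h" "a + D \<in> supp h" "supp h \<subseteq> {a..a + D}"
    using MCP_density_diamE[OF hD D] .
  have cont: "continuous_on UNIV f"
    using f by (rule locally_lipschitz_continuous_on)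
  have [measurable]: "f \<in> borel_measurable lebesgue" "deriv f \<in> borel_measurable lebesgue"
    using cont borel_measurable_deriv[OF cont]
    by (auto intro!: measurable_completion borel_measurable_continuous_onI)
  \<comment> \<open>All integrals are the same for h and H, but only H is known to satisfy the
    monotonicity at every point.\<close>
  define H where "H x = indicator (supp h) x * h x" for x
  have [measurable]: "H \<in> borel_measurable lebesgue"
    unfolding H_def by measurable
  have H0: "0 \<le> H x" for x
    using h(2) by (simp add: H_def)
  have Hh: "AE x in lebesgue. h x = H x"
    using AE_zero_outside_supp[OF \<open>h \<in> borel_measurable lebesgue\<close> h(2)]
    by eventually_elim (auto simp: H_def indicator_def)
  define c where "c = f (a + D/2)"
  \<comment> \<open>J1 is the right half, measured from the left endpoint; J2 is the left half,
    measured from the right endpoint. They omit a and a + D and share only the midpoint.\<close>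
  define J1 where "J1 = {x. D/2 \<le> 1 * (x - a) \<and> 1 * (x - a) < D}"
  define J2 where "J2 = {x. D/2 \<le> -1 * (x - (a + D)) \<and> -1 * (x - (a + D)) < D}"
  have [measurable]: "J1 \<in> sets lebesgue" "J2 \<in> sets lebesgue"
    unfolding J1_def J2_def by simp_all
  have ineq1: "?L * (\<integral>\<^sup>+x. ennreal ((f x - c)\<^sup>2 * H x) * indicator J1 x \<partial>lebesgue)
      \<le> (\<integral>\<^sup>+x. ennreal ((deriv f x)\<^sup>2 * H x) * indicator J1 x \<partial>lebesgue)"
    unfolding H_def J1_def
    by (rule MCP_density_half[OF N D DK h(1) f _ a(1)]) (simp_all add: c_def add.commute)
  have ineq2: "?L * (\<integral>\<^sup>+x. ennreal ((f x - c)\<^sup>2 * H x) * indicator J2 x \<partial>lebesgue)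
      \<le> (\<integral>\<^sup>+x. ennreal ((deriv f x)\<^sup>2 * H x) * indicator J2 x \<partial>lebesgue)"
    unfolding H_def J2_def
    by (rule MCP_density_half[OF N D DK h(1) f _ a(2)]) (simp_all add: c_def add.commute)
  have int_h: "integrable lebesgue h"
  proof -
    have "compact (supp h)"
      using hD closed_supp by (simp add: compact_eq_bounded_closed MCP_density_diam_def)
    then have "integrable lebesgue H"
      using h(1) unfolding MCP_density_def locally_integrable_def set_integrable_def H_def by simp
    then show ?thesis
      using Hh by (subst integrable_cong_AE[of _ _ H]) auto
  qed
  have int_fh: "integrable lebesgue (\<lambda>x. f x * h x)" "(\<integral>x. f x * h x \<partial>lebesgue) = 0"
    "integrable lebesgue (\<lambda>x. (f x)\<^sup>2 * h x)" "(\<integral>x. (f x)\<^sup>2 * h x \<partial>lebesgue) > 0"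
    using adm by (auto simp: admissible_def)
  have expand: "(f x - c)\<^sup>2 * h x = (f x)\<^sup>2 * h x - 2 * c * (f x * h x) + c\<^sup>2 * h x" for x
    by (simp add: power2_eq_square algebra_simps)
  have int_fc: "integrable lebesgue (\<lambda>x. (f x - c)\<^sup>2 * h x)"
    unfolding expand using int_h int_fh
    by (intro Bochner_Integration.integrable_add Bochner_Integration.integrable_diff integrable_mult_right) auto
  \<comment> \<open>The cross term vanishes because f has zero mean.\<close>
  have "(\<integral>x. (f x - c)\<^sup>2 * h x \<partial>lebesgue)
      = (\<integral>x. (f x)\<^sup>2 * h x \<partial>lebesgue) + c\<^sup>2 * (\<integral>x. h x \<partial>lebesgue)"
    unfolding expand using int_h int_fh by simp
  then have "(\<integral>x. (f x)\<^sup>2 * h x \<partial>lebesgue) \<le> (\<integral>x. (f x - c)\<^sup>2 * h x \<partial>lebesgue)"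
    using h(2) by (simp add: integral_nonneg_AE)
  moreover have nn: "(\<integral>\<^sup>+x. ennreal ((f x)\<^sup>2 * h x) \<partial>lebesgue) = ennreal (\<integral>x. (f x)\<^sup>2 * h x \<partial>lebesgue)"
    using int_fh h(2) by (intro nn_integral_eq_integral) auto
  moreover have "(\<integral>\<^sup>+x. ennreal ((f x - c)\<^sup>2 * h x) \<partial>lebesgue) = ennreal (\<integral>x. (f x - c)\<^sup>2 * h x \<partial>lebesgue)"
    using int_fc h(2) by (intro nn_integral_eq_integral) auto
  ultimately have "(\<integral>\<^sup>+x. ennreal ((f x)\<^sup>2 * h x) \<partial>lebesgue)
      \<le> (\<integral>\<^sup>+x. ennreal ((f x - c)\<^sup>2 * h x) \<partial>lebesgue)"
    by (simp add: ennreal_leI)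
  also have "\<dots> \<le> (\<integral>\<^sup>+x. ennreal ((f x - c)\<^sup>2 * H x) * indicator J1 x
      + ennreal ((f x - c)\<^sup>2 * H x) * indicator J2 x \<partial>lebesgue)"
    using Hh AE_completion[OF AE_lborel_singleton[of a]] AE_completion[OF AE_lborel_singleton[of "a + D"]]
  proof (intro nn_integral_mono_AE, eventually_elim)
    fix x assume x: "h x = H x" "x \<noteq> a" "x \<noteq> a + D"
    show "ennreal ((f x - c)\<^sup>2 * h x) \<le> ennreal ((f x - c)\<^sup>2 * H x) * indicator J1 x
      + ennreal ((f x - c)\<^sup>2 * H x) * indicator J2 x"
    proof (cases "x \<in> supp h")
      case True
      then have "a < x" "x < a + D"
        using a(3) x by force+
      then have "x \<in> J1 \<or> x \<in> J2"
        by (auto simp: J1_def J2_def field_simps)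
      then show ?thesis
        using x(1) by (auto simp: indicator_def)
    qed (use x(1) in \<open>simp add: H_def\<close>)
  qed
  also have "\<dots> = (\<integral>\<^sup>+x. ennreal ((f x - c)\<^sup>2 * H x) * indicator J1 x \<partial>lebesgue)
      + (\<integral>\<^sup>+x. ennreal ((f x - c)\<^sup>2 * H x) * indicator J2 x \<partial>lebesgue)"
    by (rule nn_integral_add) measurable
  finally have "?L * (\<integral>\<^sup>+x. ennreal ((f x)\<^sup>2 * h x) \<partial>lebesgue)
      \<le> ?L * ((\<integral>\<^sup>+x. ennreal ((f x - c)\<^sup>2 * H x) * indicator J1 x \<partial>lebesgue)
        + (\<integral>\<^sup>+x. ennreal ((f x - c)\<^sup>2 * H x) * indicator J2 x \<partial>lebesgue))"
    by (rule mult_left_mono) simp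
  also have "\<dots> \<le> (\<integral>\<^sup>+x. ennreal ((deriv f x)\<^sup>2 * H x) * indicator J1 x \<partial>lebesgue)
      + (\<integral>\<^sup>+x. ennreal ((deriv f x)\<^sup>2 * H x) * indicator J2 x \<partial>lebesgue)"
    unfolding distrib_left by (rule add_mono[OF ineq1 ineq2])
  also have "\<dots> = (\<integral>\<^sup>+x. ennreal ((deriv f x)\<^sup>2 * H x) * indicator J1 x
      + ennreal ((deriv f x)\<^sup>2 * H x) * indicator J2 x \<partial>lebesgue)"
    by (rule nn_integral_add[symmetric]) measurable
  \<comment> \<open>Only the midpoint is counted twice, and it is null.\<close>
  also have "\<dots> \<le> (\<integral>\<^sup>+x. ennreal ((deriv f x)\<^sup>2 * h x) \<partial>lebesgue)"
    using Hh AE_completion[OF AE_lborel_singleton[of "a + D/2"]]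
  proof (intro nn_integral_mono_AE, eventually_elim)
    fix x assume x: "h x = H x" "x \<noteq> a + D/2"
    then have "\<not> (x \<in> J1 \<and> x \<in> J2)"
      by (auto simp: J1_def J2_def)
    then show "ennreal ((deriv f x)\<^sup>2 * H x) * indicator J1 x
      + ennreal ((deriv f x)\<^sup>2 * H x) * indicator J2 x \<le> ennreal ((deriv f x)\<^sup>2 * h x)"
      using x(1) by (auto simp: indicator_def)
  qed
  finally have "?L * (\<integral>\<^sup>+x. ennreal ((f x)\<^sup>2 * h x) \<partial>lebesgue)
      \<le> (\<integral>\<^sup>+x. ennreal ((deriv f x)\<^sup>2 * h x) \<partial>lebesgue)" .
  then have "?L * ennreal (\<integral>x. (f x)\<^sup>2 * h x \<partial>lebesgue) / ennreal (\<integral>x. (f x)\<^sup>2 * h x \<partial>lebesgue)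
      \<le> (\<integral>\<^sup>+x. ennreal ((deriv f x)\<^sup>2 * h x) \<partial>lebesgue) / ennreal (\<integral>x. (f x)\<^sup>2 * h x \<partial>lebesgue)"
    unfolding nn by (rule divide_right_mono_ennreal)
  moreover have "ennreal (\<integral>x. (f x)\<^sup>2 * h x \<partial>lebesgue) \<noteq> 0"
    using int_fh(4) by (simp only: ennreal_eq_0_iff not_le)
  ultimately show "?L \<le> (\<integral>\<^sup>+x. ennreal ((deriv f x)\<^sup>2 * h x) \<partial>lebesgue)
      / (\<integral>\<^sup>+x. ennreal ((f x)\<^sup>2 * h x) \<partial>lebesgue)"
    unfolding nn by (subst (asm) ennreal_mult_divide_eq) auto
qed

section \<open>Sharpness\<close>

lemma supp_h_KND:
  assumes N: "1 < N" and D: "0 < D" "ereal D \<le> D_KN K N"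
  shows "supp (h_KND K N D) = {0..D}"
proof
  let ?h = "h_KND K N D"
  have h: "?h \<in> borel_measurable lebesgue" "\<And>x. 0 \<le> ?h x"
    by (auto intro!: measurable_completion simp: h_KND_nonneg)
  have "emeasure (density lebesgue (\<lambda>x. ennreal (?h x))) (- {0..D}) = 0"
    using emeasure_density_lebesgue_eq_0_iff[OF h, of "- {0..D}"] h_KND_outside[OF _ D(1)] by auto
  then show "supp ?h \<subseteq> {0..D}"
    unfolding supp_eq_Compl_Union by blast
  have "{0<..<D} \<subseteq> supp ?h"
    using h_KND_pos[OF N D(2)] by (auto intro: pos_nearby_imp_supp[OF h, of "{0<..<D}"])
  then have "closure {0<..<D} \<subseteq> supp ?h"
    using closed_supp by (rule closure_minimal)
  then show "{0..D} \<subseteq> supp ?h"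
    using D(1) by simp
qed

text \<open>Two instances of \<open>s_fun_plucker\<close> show that s(x) and s(D - x) each satisfy
  the contraction inequality, with slack s(x1) s(x - x0) and s(D - x1) s(x - x0) respectively; both
  are nonnegative as x1 lies in [0, D]. The inequality passes to the maximum.\<close>

lemma h_KND_contraction:
  assumes N: "1 < N" and D: "ereal D \<le> D_KN K N"
    and x: "0 \<le> x0" "x0 \<le> x" "x \<le> x1" "x1 \<le> D" "x0 < x1"
    and less: "ereal (x1 - x0) < D_KN K N"
  shows "(s_fun (K / (N - 1)) (x1 - x) / s_fun (K / (N - 1)) (x1 - x0)) powr (N - 1) * h_KND K N D x0
    \<le> h_KND K N D x"
proof -
  let ?s = "s_fun (K / (N - 1))"
  define q where "q y = max (?s y) (?s (D - y))" for y
  have ge: "0 \<le> ?s y" if "0 \<le> y" "y \<le> D" for y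
    using that D N by (intro s_fun_nonneg) (auto intro: order_trans[of _ "ereal D"])
  have pos: "0 < ?s (x1 - x0)"
    using N x less by (intro s_fun_pos) auto
  have "0 \<le> ?s (x1 - 0) * ?s (x - x0)"
    using x by (intro mult_nonneg_nonneg ge) auto
  also have "\<dots> = ?s (x1 - x) * ?s (0 - x0) - ?s (x1 - x0) * ?s (0 - x)"
    by (rule s_fun_plucker[symmetric])
  finally have 1: "?s (x1 - x) * ?s x0 \<le> ?s (x1 - x0) * ?s x"
    unfolding diff_0 s_fun_minus by simp
  have "0 \<le> ?s (D - x1) * ?s (x - x0)"
    using x by (intro mult_nonneg_nonneg ge) auto
  also have "\<dots> = ?s (D - x) * ?s (x1 - x0) - ?s (D - x0) * ?s (x1 - x)"
    by (rule s_fun_plucker[symmetric])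
  finally have 2: "?s (x1 - x) * ?s (D - x0) \<le> ?s (x1 - x0) * ?s (D - x)"
    by (simp add: mult.commute)
  have "?s (x1 - x0) * ?s x \<le> ?s (x1 - x0) * q x" "?s (x1 - x0) * ?s (D - x) \<le> ?s (x1 - x0) * q x"
    using pos by (auto simp: q_def)
  then have "?s (x1 - x) * q x0 \<le> ?s (x1 - x0) * q x"
    using 1 2 unfolding q_def[of x0] max_def by auto
  then have "?s (x1 - x) / ?s (x1 - x0) * q x0 \<le> q x"
    using pos by (simp add: field_simps)
  moreover have nn: "0 \<le> ?s (x1 - x) / ?s (x1 - x0)" "0 \<le> q x0"
    using pos ge[of "x1 - x"] ge[of x0] x by (auto simp: q_def le_max_iff_disj)
  ultimately have "(?s (x1 - x) / ?s (x1 - x0) * q x0) powr (N - 1) \<le> q x powr (N - 1)"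
    using N by (intro powr_mono2 mult_nonneg_nonneg) auto
  moreover have "h_KND K N D x0 = q x0 powr (N - 1)" "h_KND K N D x = q x powr (N - 1)"
    unfolding q_def using x by (auto intro: h_KND_eq_max[OF N D])
  ultimately show ?thesis
    by (simp only: powr_mult)
qed

lemma h_KND_MCP_density:
  assumes N: "1 < N" and D: "0 < D" "ereal D \<le> D_KN K N"
  shows "MCP_density K N (h_KND K N D)"
  unfolding MCP_density_def
proof (intro conjI allI ballI)
  let ?h = "h_KND K N D" and ?s = "s_fun (K / (N - 1))"
  show "0 \<le> ?h x" for x
    by (rule h_KND_nonneg)
  have "integrable lborel (\<lambda>x. indicator {0..D} x *\<^sub>R ?h x)"
    using continuous_on_h_KND[OF N D(2)] by (intro borel_integrable_compact) auto
  moreover have "(\<lambda>x. indicator {0..D} x *\<^sub>R ?h x) = ?h"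
    using h_KND_outside[OF _ D(1)] by (auto simp: indicator_def fun_eq_iff)
  ultimately have "integrable lborel ?h"
    by (simp only:)
  then have "integrable lebesgue ?h"
    by (simp add: integrable_completion)
  then show "locally_integrable ?h"
    unfolding locally_integrable_def set_integrable_def
    by (intro allI impI integrable_mult_indicator fmeasurableD lmeasurable_compact)
  fix x0 x1 t :: real
  assume "x0 \<in> supp ?h" "x1 \<in> supp ?h" and t: "t \<in> {0..1}"
  then have x: "x0 \<in> {0..D}" "x1 \<in> {0..D}"
    by (simp_all add: supp_h_KND[OF N D])
  define x where "x = t * x1 + (1 - t) * x0"
  have "ennreal_powr (sigma_coeff K N (1 - t) \<bar>x1 - x0\<bar>) (N - 1) * ennreal (?h x0) \<le> ennreal (?h x)"
  proof (cases "D_KN K N \<le> ereal \<bar>x1 - x0\<bar>")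
    \<comment> \<open>An infinite coefficient arises only between the two ends of [0, D] with D
      equal to \<open>D_KN K N\<close>. There s(D) = 0, so the model vanishes at both ends and the
      convention on infinity times zero applies.\<close>
    case True
    then have "ereal D \<le> ereal \<bar>x1 - x0\<bar>"
      using D(2) by (rule order_trans[rotated])
    then have ends: "x0 = 0 \<and> x1 = D \<or> x0 = D \<and> x1 = 0"
      using x by (auto simp: abs_if split: if_splits)
    then have "\<bar>x1 - x0\<bar> = D"
      using D(1) by auto
    then have "D_KN K N = ereal D"
      using True D(2) by (auto intro: order.antisym)
    then have "K > 0" "D = pi / sqrt (K / (N - 1))"
      by (auto simp: D_KN_def split: if_splits)
    then have "?s D = 0"
      using N by (simp add: s_fun_def)
    then have "?h x0 = 0"
      using ends D(1) by (auto simp: h_KND_def)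
    then show ?thesis
      by simp
  next
    case False
    then have less: "ereal \<bar>x1 - x0\<bar> < D_KN K N"
      by simp
    have le: "ennreal_powr (ennreal r) (N - 1) * ennreal (?h x0) \<le> ennreal (?h x)"
      if "r powr (N - 1) * ?h x0 \<le> ?h x" "0 \<le> r" for r
      using that by (simp add: ennreal_powr_def h_KND_nonneg flip: ennreal_mult)
    consider "x0 = x1" | "x0 < x1" | "x1 < x0"
      by linarith
    then show ?thesis
    proof cases
      \<comment> \<open>The quotient of values of \<open>s_fun\<close> would be 0/0 here; the
        coefficient is 1 - t by definition.\<close>
      case 1
      have "(1 - t) powr (N - 1) \<le> 1"
        using t N by (intro powr_le1) auto
      then have "(1 - t) powr (N - 1) * ?h x0 \<le> ?h x"
        using 1 mult_right_mono[OF _ h_KND_nonneg[of K N D x0], of "(1 - t) powr (N - 1)" 1]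
        by (simp add: x_def algebra_simps)
      then show ?thesis
        using le[of "1 - t"] 1 t False by (simp add: sigma_coeff_def)
    next
      case 2
      have eq: "(1 - t) * \<bar>x1 - x0\<bar> = x1 - x" "\<bar>x1 - x0\<bar> = x1 - x0"
        using 2 by (simp_all add: x_def algebra_simps)
      have "0 \<le> t * (x1 - x0)" "0 \<le> (1 - t) * (x1 - x0)"
        using 2 t by auto
      then have bd: "x0 \<le> x" "x \<le> x1"
        by (auto simp: x_def algebra_simps)
      have "0 \<le> ?s (x1 - x) / ?s (x1 - x0)"
        using N 2 bd less unfolding eq
        by (intro divide_nonneg_nonneg s_fun_nonneg) (auto intro: order_trans[of _ "ereal (x1 - x0)"])
      moreover have "sigma_coeff K N (1 - t) \<bar>x1 - x0\<bar> = ennreal (?s (x1 - x) / ?s (x1 - x0))"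
        unfolding sigma_coeff_def eq(1) using False 2 by simp
      ultimately show ?thesis
        using le[OF h_KND_contraction[OF N D(2), of x0 x x1]] x bd 2 less by simp
    next
      case 3
      have eq: "(1 - t) * \<bar>x1 - x0\<bar> = x - x1" "\<bar>x1 - x0\<bar> = x0 - x1"
        using 3 by (simp_all add: x_def algebra_simps)
      have "0 \<le> t * (x0 - x1)" "0 \<le> (1 - t) * (x0 - x1)"
        using 3 t by auto
      then have bd: "x1 \<le> x" "x \<le> x0"
        by (auto simp: x_def algebra_simps)
      have nn: "0 \<le> ?s (x - x1) / ?s (x0 - x1)"
        using N 3 bd less unfolding eq
        by (intro divide_nonneg_nonneg s_fun_nonneg) (auto intro: order_trans[of _ "ereal (x0 - x1)"])
      \<comment> \<open>Contraction to the left is contraction to the right after the reflection x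
        -> D - x, which preserves the model density.\<close>
      have "(?s (x - x1) / ?s (x0 - x1)) powr (N - 1) * ?h x0 \<le> ?h x"
        using h_KND_contraction[OF N D(2), of "D - x0" "D - x" "D - x1"] x bd 3 less
        by (simp add: eq h_KND_reflect[OF D(1)])
      moreover have "sigma_coeff K N (1 - t) \<bar>x1 - x0\<bar> = ennreal (?s (x - x1) / ?s (x0 - x1))"
        unfolding sigma_coeff_def eq(1) using False 3 by simp
      ultimately show ?thesis
        using le[OF _ nn] by simp
    qed
  qed
  then show "ennreal_powr (sigma_coeff K N (1 - t) \<bar>x1 - x0\<bar>) (N - 1) * ennreal (?h x0)
      \<le> ennreal (?h (t * x1 + (1 - t) * x0))"
    unfolding x_def .
qed

lemma h_KND_MCP_density_diam:
  assumes "1 < N" "0 < D" "ereal D \<le> D_KN K N"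
  shows "MCP_density_diam K N D (h_KND K N D)"
  using assms h_KND_MCP_density[OF assms]
  by (simp add: MCP_density_diam_def supp_h_KND diameter_closed_interval)

text \<open>Sharpness is restricted to D \<le> \<open>D_KN K N\<close> because for larger D there
  are no densities of that diameter, by \<open>MCP_density_diam_le\<close>, and every constant would
  be a lower bound.\<close>

theorem proposition4p8:
  fixes K N D :: real
  assumes "1 < N" and "0 < D"
  shows "(\<forall>h. MCP_density_diam K N D h \<longrightarrow> spectral_gap (h_KND K N D) \<le> spectral_gap h)
    \<and> (ereal D \<le> D_KN K N \<longrightarrow>
         (\<forall>c::ennreal. (\<forall>h. MCP_density_diam K N D h \<longrightarrow> c \<le> spectral_gap h)
            \<longrightarrow> c \<le> spectral_gap (h_KND K N D)))"
  using spectral_gap_MCP_ge[OF assms] h_KND_MCP_density_diam[OF assms] by blast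

end
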